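(* Let $R$ be a commutative ring with identity ($1\neq 0$), let $A=\{f\in R[X] : f(0)=1\}$, and let $R[X]_A$ be the Anderson ring of $R$. If $R$ is finite dimensional, then $\dim(R[X])=\dim(R[X]_A)$, and hence $n+1\le \dim(R[X]_A)\le 2n+1$ if $\dim(R)=n$.
   Context: $\dim$ denotes Krull dimension. $R[X]$ is the polynomial ring in one variable; the Anderson ring $R[X]_A$ is the localization of $R[X]$ at the multiplicative set $A$ of polynomials with constant term $1$. *)

theory Defs
  imports "HOL-Algebra.UnivPoly" "HOL-Algebra.Ideal" "HOL-Library.Extended_Nat"
begin

section \<open>Krull dimension\<close>

text \<open>
  The supremum of the lengths \<open>n\<close> of strict chains \<open>P 0 \<subset> P 1 \<subset> \<dots> \<subset> P n\<close> of prime
  ideals. The value \<open>\<infinity>\<close> is attained exactly if the lengths are unbounded. Every nonzero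
  commutative ring has a prime ideal, so the supremum is over a nonempty set; for the zero ring
  the value is the junk value \<open>0 = Sup {}\<close>.
\<close>

definition prime_chain :: "('a, 'm) ring_scheme \<Rightarrow> nat \<Rightarrow> (nat \<Rightarrow> 'a set) \<Rightarrow> bool" where
  "prime_chain R n P \<longleftrightarrow> (\<forall>i\<le>n. primeideal (P i) R) \<and> (\<forall>i<n. P i \<subset> P (Suc i))"

definition krull_dim :: "('a, 'm) ring_scheme \<Rightarrow> enat" where
  "krull_dim R = Sup {enat n | n. \<exists>P. prime_chain R n P}"


section \<open>Localization at a multiplicative set\<close>

definition frac_rel :: "('a, 'm) ring_scheme \<Rightarrow> 'a set \<Rightarrow> (('a \<times> 'a) \<times> ('a \<times> 'a)) set" where
  "frac_rel R S = {((a, s), (b, t)). a \<in> carrier R \<and> s \<in> S \<and> b \<in> carrier R \<and> t \<in> S \<and>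
     (\<exists>u\<in>S. u \<otimes>\<^bsub>R\<^esub> (a \<otimes>\<^bsub>R\<^esub> t) = u \<otimes>\<^bsub>R\<^esub> (b \<otimes>\<^bsub>R\<^esub> s))}"

text \<open>The fraction \<open>a / s\<close>.\<close>

definition frac_class :: "('a, 'm) ring_scheme \<Rightarrow> 'a set \<Rightarrow> 'a \<Rightarrow> 'a \<Rightarrow> ('a \<times> 'a) set" where
  "frac_class R S a s = frac_rel R S `` {(a, s)}"

text \<open>
  The unions over representatives are the usual lifting of a function to equivalence classes: all
  the united sets coincide (see \<open>localization_add\<close> and \<open>localization_mult\<close> below).
\<close>

definition localization :: "('a, 'm) ring_scheme \<Rightarrow> 'a set \<Rightarrow> ('a \<times> 'a) set ring" where
  "localization R S = \<lparr>
     carrier = (carrier R \<times> S) // frac_rel R S,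
     mult = (\<lambda>x y. \<Union>(a, s)\<in>x. \<Union>(b, t)\<in>y. frac_class R S (a \<otimes>\<^bsub>R\<^esub> b) (s \<otimes>\<^bsub>R\<^esub> t)),
     one = frac_class R S \<one>\<^bsub>R\<^esub> \<one>\<^bsub>R\<^esub>,
     zero = frac_class R S \<zero>\<^bsub>R\<^esub> \<one>\<^bsub>R\<^esub>,
     add = (\<lambda>x y. \<Union>(a, s)\<in>x. \<Union>(b, t)\<in>y.
              frac_class R S (a \<otimes>\<^bsub>R\<^esub> t \<oplus>\<^bsub>R\<^esub> b \<otimes>\<^bsub>R\<^esub> s) (s \<otimes>\<^bsub>R\<^esub> t))\<rparr>"

locale mult_submonoid = cring R + submonoid S R for R (structure) and S
begin

lemma mem_carrier: "s \<in> S \<Longrightarrow> s \<in> carrier R"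
  using subset by blast

lemma equiv_frac_rel: "equiv (carrier R \<times> S) (frac_rel R S)"
proof (rule equivI)
  show "frac_rel R S \<subseteq> (carrier R \<times> S) \<times> (carrier R \<times> S)"
    by (auto simp: frac_rel_def)
  show "refl_on (carrier R \<times> S) (frac_rel R S)"
    by (auto simp: refl_on_def frac_rel_def)
  show "sym (frac_rel R S)"
    by (rule symI) (auto simp: frac_rel_def intro: sym)
  show "trans (frac_rel R S)"
  proof (rule transI, clarsimp simp: frac_rel_def)
    fix a s b t c r u v
    assume mem: "a \<in> carrier R" "b \<in> carrier R" "c \<in> carrier R" "s \<in> S" "t \<in> S" "r \<in> S"
        "u \<in> S" "v \<in> S"
      and 1: "u \<otimes> (a \<otimes> t) = u \<otimes> (b \<otimes> s)" and 2: "v \<otimes> (b \<otimes> r) = v \<otimes> (c \<otimes> t)"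
    note car = mem mem_carrier[OF mem(4)] mem_carrier[OF mem(5)] mem_carrier[OF mem(6)]
      mem_carrier[OF mem(7)] mem_carrier[OF mem(8)]
    have "(t \<otimes> (u \<otimes> v)) \<otimes> (a \<otimes> r) = (v \<otimes> r) \<otimes> (u \<otimes> (a \<otimes> t))"
      using car by (simp add: m_ac)
    also have "\<dots> = (u \<otimes> s) \<otimes> (v \<otimes> (b \<otimes> r))"
      unfolding 1 using car by (simp add: m_ac)
    also have "\<dots> = (t \<otimes> (u \<otimes> v)) \<otimes> (c \<otimes> s)"
      unfolding 2 using car by (simp add: m_ac)
    finally show "\<exists>w\<in>S. w \<otimes> (a \<otimes> r) = w \<otimes> (c \<otimes> s)"
      using mem by (intro bexI[of _ "t \<otimes> (u \<otimes> v)"]) auto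
  qed
qed

lemma frac_class_eq_iff:
  assumes "a \<in> carrier R" "s \<in> S" "b \<in> carrier R" "t \<in> S"
  shows "frac_class R S a s = frac_class R S b t \<longleftrightarrow>
    (\<exists>u\<in>S. u \<otimes> (a \<otimes> t) = u \<otimes> (b \<otimes> s))"
  unfolding frac_class_def
  using eq_equiv_class_iff[OF equiv_frac_rel, of "(a, s)" "(b, t)"] assms
  by (simp add: frac_rel_def)

lemma frac_class_mem: "(b, t) \<in> frac_class R S a s \<longleftrightarrow>
    a \<in> carrier R \<and> s \<in> S \<and> b \<in> carrier R \<and> t \<in> S \<and> frac_class R S b t = frac_class R S a s"
  using frac_class_eq_iff[of a s b t] by (auto simp: frac_class_def frac_rel_def)

lemma frac_class_in_carrier [simp, intro]:
  "a \<in> carrier R \<Longrightarrow> s \<in> S \<Longrightarrow> frac_class R S a s \<in> carrier (localization R S)"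
  by (auto simp: localization_def frac_class_def intro: quotientI)

lemma localization_carrierE:
  assumes "x \<in> carrier (localization R S)"
  obtains a s where "a \<in> carrier R" "s \<in> S" "x = frac_class R S a s"
  using assms by (auto simp: localization_def frac_class_def elim!: quotientE)

lemma UN_frac_class:
  assumes mem: "a \<in> carrier R" "s \<in> S" "b \<in> carrier R" "t \<in> S"
    and cong: "\<And>a' s' b' t'. \<lbrakk>a' \<in> carrier R; s' \<in> S; b' \<in> carrier R; t' \<in> S;
      frac_class R S a' s' = frac_class R S a s; frac_class R S b' t' = frac_class R S b t\<rbrakk> \<Longrightarrow>
      h a' s' b' t' = h a s b t"
  shows "(\<Union>(a', s')\<in>frac_class R S a s. \<Union>(b', t')\<in>frac_class R S b t. h a' s' b' t') = h a s b t"
proof -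
  have 1: "\<And>a' s' b' t'. (a', s') \<in> frac_class R S a s \<Longrightarrow> (b', t') \<in> frac_class R S b t \<Longrightarrow>
      h a' s' b' t' = h a s b t"
    by (rule cong) (simp_all add: frac_class_mem)
  have 2: "(a, s) \<in> frac_class R S a s" "(b, t) \<in> frac_class R S b t"
    using mem by (simp_all add: frac_class_mem)
  show ?thesis
    using 1 2 by fast
qed

lemma localization_mult:
  assumes mem: "a \<in> carrier R" "s \<in> S" "b \<in> carrier R" "t \<in> S"
  shows "frac_class R S a s \<otimes>\<^bsub>localization R S\<^esub> frac_class R S b t =
    frac_class R S (a \<otimes> b) (s \<otimes> t)"
proof -
  have "frac_class R S (a' \<otimes> b') (s' \<otimes> t') = frac_class R S (a \<otimes> b) (s \<otimes> t)"
    if mem': "a' \<in> carrier R" "s' \<in> S" "b' \<in> carrier R" "t' \<in> S"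
      and 1: "frac_class R S a' s' = frac_class R S a s"
      and 2: "frac_class R S b' t' = frac_class R S b t"
    for a' s' b' t'
  proof -
    obtain u where u: "u \<in> S" "u \<otimes> (a' \<otimes> s) = u \<otimes> (a \<otimes> s')"
      using 1 mem mem' by (auto simp: frac_class_eq_iff)
    obtain v where v: "v \<in> S" "v \<otimes> (b' \<otimes> t) = v \<otimes> (b \<otimes> t')"
      using 2 mem mem' by (auto simp: frac_class_eq_iff)
    have c: "s \<in> carrier R" "t \<in> carrier R" "s' \<in> carrier R" "t' \<in> carrier R"
        "u \<in> carrier R" "v \<in> carrier R"
      using mem mem' u v mem_carrier by auto
    have "(u \<otimes> v) \<otimes> ((a' \<otimes> b') \<otimes> (s \<otimes> t)) = (u \<otimes> (a' \<otimes> s)) \<otimes> (v \<otimes> (b' \<otimes> t))"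
      using mem mem' c by (simp add: m_ac)
    also have "\<dots> = (u \<otimes> v) \<otimes> ((a \<otimes> b) \<otimes> (s' \<otimes> t'))"
      unfolding u v using mem mem' c by (simp add: m_ac)
    finally show ?thesis
      using mem mem' u v by (subst frac_class_eq_iff) auto
  qed
  then show ?thesis
    using UN_frac_class[OF mem, where h = "\<lambda>a s b t. frac_class R S (a \<otimes> b) (s \<otimes> t)"]
    by (simp add: localization_def)
qed

lemma localization_add:
  assumes mem: "a \<in> carrier R" "s \<in> S" "b \<in> carrier R" "t \<in> S"
  shows "frac_class R S a s \<oplus>\<^bsub>localization R S\<^esub> frac_class R S b t =
    frac_class R S (a \<otimes> t \<oplus> b \<otimes> s) (s \<otimes> t)"
proof -
  have "frac_class R S (a' \<otimes> t' \<oplus> b' \<otimes> s') (s' \<otimes> t') =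
      frac_class R S (a \<otimes> t \<oplus> b \<otimes> s) (s \<otimes> t)"
    if mem': "a' \<in> carrier R" "s' \<in> S" "b' \<in> carrier R" "t' \<in> S"
      and 1: "frac_class R S a' s' = frac_class R S a s"
      and 2: "frac_class R S b' t' = frac_class R S b t"
    for a' s' b' t'
  proof -
    obtain u where u: "u \<in> S" "u \<otimes> (a' \<otimes> s) = u \<otimes> (a \<otimes> s')"
      using 1 mem mem' by (auto simp: frac_class_eq_iff)
    obtain v where v: "v \<in> S" "v \<otimes> (b' \<otimes> t) = v \<otimes> (b \<otimes> t')"
      using 2 mem mem' by (auto simp: frac_class_eq_iff)
    have c: "s \<in> carrier R" "t \<in> carrier R" "s' \<in> carrier R" "t' \<in> carrier R"
        "u \<in> carrier R" "v \<in> carrier R"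
      using mem mem' u v mem_carrier by auto
    have "(u \<otimes> v) \<otimes> ((a' \<otimes> t' \<oplus> b' \<otimes> s') \<otimes> (s \<otimes> t)) =
        (v \<otimes> (t \<otimes> t')) \<otimes> (u \<otimes> (a' \<otimes> s)) \<oplus> (u \<otimes> (s \<otimes> s')) \<otimes> (v \<otimes> (b' \<otimes> t))"
      using mem mem' c by (simp add: m_ac l_distr r_distr)
    also have "\<dots> = (u \<otimes> v) \<otimes> ((a \<otimes> t \<oplus> b \<otimes> s) \<otimes> (s' \<otimes> t'))"
      unfolding u v using mem mem' c by (simp add: m_ac l_distr r_distr)
    finally show ?thesis
      using mem mem' c u v by (subst frac_class_eq_iff) auto
  qed
  then show ?thesis
    using UN_frac_class[OF mem,
        where h = "\<lambda>a s b t. frac_class R S (a \<otimes> t \<oplus> b \<otimes> s) (s \<otimes> t)"]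
    by (simp add: localization_def)
qed

lemma localization_one: "\<one>\<^bsub>localization R S\<^esub> = frac_class R S \<one> \<one>"
  and localization_zero: "\<zero>\<^bsub>localization R S\<^esub> = frac_class R S \<zero> \<one>"
  by (simp_all add: localization_def)

lemma frac_class_eqI:
  assumes "a \<in> carrier R" "s \<in> S" "b \<in> carrier R" "t \<in> S" "a \<otimes> t = b \<otimes> s"
  shows "frac_class R S a s = frac_class R S b t"
  using assms by (subst frac_class_eq_iff) (auto intro: bexI[of _ \<one>])

lemma cring_localization: "cring (localization R S)"
proof (rule cringI)
  let ?L = "localization R S"
  note simps = localization_add localization_mult localization_one localization_zero mem_carrier
  show "abelian_group ?L"
  proof (rule abelian_groupI)
    fix x y z assume "x \<in> carrier ?L" "y \<in> carrier ?L" "z \<in> carrier ?L"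
    then show "(x \<oplus>\<^bsub>?L\<^esub> y) \<oplus>\<^bsub>?L\<^esub> z = x \<oplus>\<^bsub>?L\<^esub> (y \<oplus>\<^bsub>?L\<^esub> z)"
      by (elim localization_carrierE)
        (auto simp: simps l_distr r_distr m_ac a_ac intro!: frac_class_eqI)
  next
    fix x assume "x \<in> carrier ?L"
    then obtain a s where x: "a \<in> carrier R" "s \<in> S" "x = frac_class R S a s"
      by (rule localization_carrierE)
    have "frac_class R S (\<ominus> a) s \<oplus>\<^bsub>?L\<^esub> x = \<zero>\<^bsub>?L\<^esub>"
      unfolding localization_zero using x
      by (simp add: simps l_minus l_neg) (rule frac_class_eqI, auto simp: mem_carrier)
    then show "\<exists>y\<in>carrier ?L. y \<oplus>\<^bsub>?L\<^esub> x = \<zero>\<^bsub>?L\<^esub>"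
      using x by blast
  qed (auto simp: simps l_distr r_distr m_ac a_ac intro!: frac_class_eqI
      elim!: localization_carrierE)
  show "comm_monoid ?L"
    by (rule comm_monoidI)
      (auto simp: simps m_ac intro!: frac_class_eqI elim!: localization_carrierE)
  fix x y z assume "x \<in> carrier ?L" "y \<in> carrier ?L" "z \<in> carrier ?L"
  then show "(x \<oplus>\<^bsub>?L\<^esub> y) \<otimes>\<^bsub>?L\<^esub> z = x \<otimes>\<^bsub>?L\<^esub> z \<oplus>\<^bsub>?L\<^esub> y \<otimes>\<^bsub>?L\<^esub> z"
    by (elim localization_carrierE)
      (simp add: simps, rule frac_class_eqI, auto simp: simps l_distr r_distr m_ac a_ac)
qed

end


section \<open>The Anderson ring\<close>

definition anderson_set :: "('a, 'm) ring_scheme \<Rightarrow> (nat \<Rightarrow> 'a) set" where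
  "anderson_set R = {f \<in> carrier (UP R). coeff (UP R) f 0 = \<one>\<^bsub>R\<^esub>}"

definition anderson_ring :: "('a, 'm) ring_scheme \<Rightarrow> ((nat \<Rightarrow> 'a) \<times> (nat \<Rightarrow> 'a)) set ring" where
  "anderson_ring R = localization (UP R) (anderson_set R)"

lemma mult_submonoid_anderson:
  assumes "cring R"
  shows "mult_submonoid (UP R) (anderson_set R)"
proof -
  interpret UP_cring R "UP R"
    using assms by (simp_all add: UP_cring_def)
  show ?thesis
    by unfold_locales (auto simp: anderson_set_def)
qed

end

theory Submission
  imports Defs "HOL-Algebra.Ring_Divisibility"
begin

text \<open>
  Localizing never raises the dimension, because primes of a localization correspond to the primes
  that are disjoint from the multiplicative set (\<open>krull_dim_localization_le\<close>,
  \<open>prime_chain_localization\<close>). For the opposite inequality it suffices to replace any chain of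
  primes of \<open>R[X]\<close> by one of the same length whose top is disjoint from \<open>A\<close>. For a
  prime \<open>p\<close> of \<open>R\<close> the ideal \<open>p + X R[X]\<close> is prime and consists of
  polynomials with constant term in \<open>p\<close>, so neither it nor the smaller prime \<open>p[X]\<close>
  meets \<open>A\<close>.

  Everything else rests on one fact about the fibres of \<open>Spec R[X] \<rightarrow> Spec R\<close>: if
  \<open>Q \<subset> Q'\<close> are primes with the same contraction \<open>p\<close>, then \<open>Q = p[X]\<close>
  (\<open>eq_poly_ideal_of_psubset\<close>). The reason is that the fibre over \<open>p\<close> is the spectrum of
  the principal ideal domain \<open>k(p)[X]\<close>, where nonzero primes are maximal; division with
  remainder up to a factor outside \<open>p\<close> makes this argument work in \<open>R[X]\<close> itself.

  The fact has two consequences. First, if a chain ends at a prime \<open>Q \<noteq> p[X]\<close> over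
  \<open>p\<close>, then a chain that is shorter by only one step ends at \<open>p[X]\<close>
  (\<open>prime_chain_to_poly_ideal\<close>, Jaffard's special chain theorem in one variable). Adding
  \<open>p + X R[X]\<close> on top restores the length, and the new chain survives in the Anderson ring.
  Secondly, no three primes of a chain share a contraction, so every second prime of a chain of
  length \<open>d\<close> contracts to a chain of length \<open>d div 2\<close> in \<open>R\<close>, which gives the
  bound \<open>2n + 1\<close>. The bound \<open>n + 1\<close> comes from extending a chain
  \<open>p 0 \<subset> \<dots> \<subset> p n\<close> to \<open>R[X]\<close> and adding \<open>p n + X R[X]\<close>.
\<close>

section \<open>Chains of prime ideals\<close>

lemma prime_chain_snoc:
  assumes "prime_chain R n P" "primeideal Q R" "P n \<subset> Q"
  shows "prime_chain R (Suc n) (P(Suc n := Q))"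
  using assms by (auto simp: prime_chain_def le_Suc_eq less_Suc_eq)

lemma prime_chain_butlast: "prime_chain R (Suc n) P \<Longrightarrow> prime_chain R n P"
  by (auto simp: prime_chain_def)

lemma prime_chain_map:
  assumes "prime_chain R n P"
    and "\<And>i. i \<le> n \<Longrightarrow> primeideal (F (P i)) S"
    and "\<And>I J. primeideal I R \<Longrightarrow> primeideal J R \<Longrightarrow> I \<subset> J \<Longrightarrow> F I \<subset> F J"
  shows "prime_chain S n (\<lambda>i. F (P i))"
  using assms by (auto simp: prime_chain_def)

lemma prime_chain_subset_last:
  assumes "prime_chain R n P" "i \<le> n"
  shows "P i \<subseteq> P n"
  using assms(2,1)
  by (induction rule: inc_induct) (auto simp: prime_chain_def)

lemma prime_chain_le_krull_dim: "prime_chain R n P \<Longrightarrow> enat n \<le> krull_dim R"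
  unfolding krull_dim_def by (rule Sup_upper) blast

lemma krull_dim_leI:
  assumes "\<And>n P. prime_chain R n P \<Longrightarrow> enat n \<le> d"
  shows "krull_dim R \<le> d"
  unfolding krull_dim_def using assms by (auto intro!: Sup_least)

lemma krull_dim_mono:
  assumes "\<And>n P. prime_chain R n P \<Longrightarrow> \<exists>P'. prime_chain S n P'"
  shows "krull_dim R \<le> krull_dim S"
proof (rule krull_dim_leI)
  fix n P assume "prime_chain R n P"
  then obtain P' where "prime_chain S n P'"
    using assms by blast
  then show "enat n \<le> krull_dim S"
    by (rule prime_chain_le_krull_dim)
qed

lemma (in primeideal) one_not_mem: "\<one> \<notin> I"
  using one_imp_carrier I_notcarr by auto

lemma (in cring) exists_maximalideal:
  assumes "\<one> \<noteq> \<zero>"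
  shows "\<exists>M. maximalideal M R"
proof -
  let ?A = "{I. ideal I R \<and> \<one> \<notin> I}"
  have "\<exists>M\<in>?A. \<forall>X\<in>?A. M \<subseteq> X \<longrightarrow> X = M"
  proof (rule subset_Zorn_nonempty)
    show "?A \<noteq> {}"
      using assms zeroideal by blast
  next
    fix C assume C: "C \<noteq> {}" "subset.chain ?A C"
    then have "subset.chain {I. ideal I R} C"
      by (auto simp: pred_on.chain_def)
    from chain_Union_is_ideal[OF this] C show "\<Union>C \<in> ?A"
      by (auto simp: pred_on.chain_def)
  qed
  then obtain M where M: "ideal M R" "\<one> \<notin> M" and max: "\<And>J. ideal J R \<Longrightarrow> \<one> \<notin> J \<Longrightarrow> M \<subseteq> J \<Longrightarrow> J = M"
    by blast
  have "maximalideal M R"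
    using M max by (intro maximalidealI) (auto dest: ideal.one_imp_carrier)
  then show ?thesis ..
qed

text \<open>
  A finite supremum of lengths is attained. Length \<open>0\<close> needs a separate argument: the value
  \<open>0\<close> would also be the supremum of an empty set of lengths, so a prime ideal has to be found.
\<close>

lemma (in cring) prime_chain_of_krull_dim:
  assumes "\<one> \<noteq> \<zero>" "krull_dim R = enat n"
  shows "\<exists>P. prime_chain R n P"
proof (cases n)
  case 0
  obtain M where "primeideal M R"
    using exists_maximalideal[OF assms(1)] maximalideal_prime by blast
  with 0 have "prime_chain R n (\<lambda>_. M)"
    by (simp add: prime_chain_def)
  then show ?thesis by blast
next
  case (Suc m)
  have "\<exists>k P. prime_chain R k P \<and> m < k"
  proof (rule ccontr)
    assume "\<not> ?thesis"
    then have "krull_dim R \<le> enat m"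
      by (auto intro!: krull_dim_leI simp: not_less)
    then show False
      using assms(2) Suc by simp
  qed
  then obtain k P where "prime_chain R k P" "n \<le> k"
    using Suc by auto
  then have "prime_chain R n P"
    by (auto simp: prime_chain_def)
  then show ?thesis by blast
qed


section \<open>Prime ideals of a localization\<close>

context mult_submonoid
begin

abbreviation Loc where "Loc \<equiv> localization R S"

lemma frac_ring_hom: "ring_hom_ring R Loc (\<lambda>a. frac_class R S a \<one>)"
proof -
  interpret L: cring Loc by (rule cring_localization)
  show ?thesis
    by (rule ring_hom_ringI)
      (auto simp: localization_mult localization_add localization_one ring_axioms L.ring_axioms)
qed

text \<open>
  A prime of the localization does not see denominators, which are units; hence it is
  determined by its contraction.
\<close>

lemma primeideal_localization_mem_iff:
  assumes "primeideal Q Loc" "a \<in> carrier R" "s \<in> S"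
  shows "frac_class R S a s \<in> Q \<longleftrightarrow> frac_class R S a \<one> \<in> Q"
proof -
  interpret Q: primeideal Q Loc by fact
  have 1: "frac_class R S a \<one> = frac_class R S a s \<otimes>\<^bsub>Loc\<^esub> frac_class R S s \<one>"
    and 2: "frac_class R S a s = frac_class R S a \<one> \<otimes>\<^bsub>Loc\<^esub> frac_class R S \<one> s"
    using assms by (simp_all add: localization_mult mem_carrier)
      (rule frac_class_eqI, auto simp: mem_carrier)
  show ?thesis
  proof
    assume "frac_class R S a s \<in> Q"
    then show "frac_class R S a \<one> \<in> Q"
      unfolding 1 using assms by (intro Q.I_r_closed) (auto simp: mem_carrier)
  next
    assume "frac_class R S a \<one> \<in> Q"
    then show "frac_class R S a s \<in> Q"
      by (subst 2) (use assms in \<open>auto intro!: Q.I_r_closed\<close>)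
  qed
qed

lemma krull_dim_localization_le: "krull_dim Loc \<le> krull_dim R"
proof (rule krull_dim_mono)
  fix n P assume P: "prime_chain Loc n P"
  interpret h: ring_hom_ring R Loc "\<lambda>a. frac_class R S a \<one>"
    by (rule frac_ring_hom)
  let ?F = "\<lambda>Q. {a \<in> carrier R. frac_class R S a \<one> \<in> Q}"
  have "prime_chain R n (\<lambda>i. ?F (P i))"
  proof (rule prime_chain_map[OF P])
    show "primeideal (?F (P i)) R" if "i \<le> n" for i
      using P that by (intro h.primeideal_vimage is_cring) (auto simp: prime_chain_def)
  next
    fix I J assume IJ: "primeideal I Loc" "primeideal J Loc" "I \<subset> J"
    then obtain x where x: "x \<in> J" "x \<notin> I" by blast
    interpret J: primeideal J Loc by fact
    have "x \<in> carrier Loc"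
      using J.a_subset x by blast
    then obtain a s where a: "a \<in> carrier R" "s \<in> S" "x = frac_class R S a s"
      by (rule localization_carrierE)
    then have "a \<in> ?F J" "a \<notin> ?F I"
      using x primeideal_localization_mem_iff[OF IJ(1) a(1,2)]
        primeideal_localization_mem_iff[OF IJ(2) a(1,2)] by auto
    then show "?F I \<subset> ?F J"
      using IJ by blast
  qed
  then show "\<exists>P'. prime_chain R n P'" by blast
qed

definition ext_ideal where
  "ext_ideal I = {frac_class R S a s | a s. a \<in> I \<and> s \<in> S}"

text \<open>
  Here disjointness from \<open>S\<close> and primality enter: an equality of fractions is an equation in
  \<open>R\<close> only after multiplication by an element of \<open>S\<close>, and this factor can be
  cancelled modulo \<open>I\<close>. Thus \<open>I\<close> is recovered from its extension.
\<close>

lemma frac_class_in_ext_ideal_iff: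
  assumes I: "primeideal I R" "I \<inter> S = {}" and "a \<in> carrier R" "s \<in> S"
  shows "frac_class R S a s \<in> ext_ideal I \<longleftrightarrow> a \<in> I"
proof
  interpret I: primeideal I R by fact
  assume "frac_class R S a s \<in> ext_ideal I"
  then obtain b t where b: "b \<in> I" "t \<in> S" "frac_class R S a s = frac_class R S b t"
    by (auto simp: ext_ideal_def)
  then obtain u where u: "u \<in> S" "u \<otimes> (a \<otimes> t) = u \<otimes> (b \<otimes> s)"
    using assms by (auto simp: frac_class_eq_iff I.a_Hcarr)
  have "u \<otimes> (b \<otimes> s) \<in> I"
    using b u assms by (intro I.I_l_closed I.I_r_closed) (auto simp: mem_carrier)
  then have "u \<otimes> (a \<otimes> t) \<in> I"
    using u by simp
  then have "u \<in> I \<or> a \<in> I \<or> t \<in> I"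
    using I.I_prime[of u "a \<otimes> t"] I.I_prime[of a t] u b assms by (auto simp: mem_carrier)
  then show "a \<in> I"
    using I u b by auto
qed (use assms in \<open>auto simp: ext_ideal_def\<close>)

lemma primeideal_ext_ideal:
  assumes I: "primeideal I R" "I \<inter> S = {}"
  shows "primeideal (ext_ideal I) Loc"
proof -
  interpret I: primeideal I R by fact
  interpret L: cring Loc by (rule cring_localization)
  have mem: "\<And>a s. a \<in> carrier R \<Longrightarrow> s \<in> S \<Longrightarrow> frac_class R S a s \<in> ext_ideal I \<longleftrightarrow> a \<in> I"
    by (rule frac_class_in_ext_ideal_iff[OF I])
  have sub: "ext_ideal I \<subseteq> carrier Loc"
    by (auto simp: ext_ideal_def I.a_Hcarr)
  have "ideal (ext_ideal I) Loc"
  proof (rule idealI[OF L.ring_axioms])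
    show "subgroup (ext_ideal I) (add_monoid Loc)"
    proof (rule L.add.subgroupI[OF sub])
      show "ext_ideal I \<noteq> {}"
        using mem[of \<zero> \<one>] by auto
    next
      fix x assume "x \<in> ext_ideal I"
      then obtain a s where a: "a \<in> I" "s \<in> S" "x = frac_class R S a s"
        by (auto simp: ext_ideal_def)
      have "frac_class R S (\<ominus> a) s \<oplus>\<^bsub>Loc\<^esub> x = \<zero>\<^bsub>Loc\<^esub>"
        unfolding localization_zero using a
        by (simp add: localization_add I.a_Hcarr mem_carrier l_minus l_neg)
          (rule frac_class_eqI, auto simp: mem_carrier)
      then have "\<ominus>\<^bsub>Loc\<^esub> x = frac_class R S (\<ominus> a) s"
        using a by (intro L.minus_equality) (auto simp: I.a_Hcarr)
      then show "\<ominus>\<^bsub>Loc\<^esub> x \<in> ext_ideal I"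
        using a by (simp add: mem I.a_Hcarr)
    next
      fix x y assume "x \<in> ext_ideal I" "y \<in> ext_ideal I"
      then show "x \<oplus>\<^bsub>Loc\<^esub> y \<in> ext_ideal I"
        by (auto simp: ext_ideal_def localization_add I.a_Hcarr)
          (metis I.I_r_closed I.a_closed m_closed mem_carrier)
    qed
  next
    fix x y assume *: "x \<in> ext_ideal I" "y \<in> carrier Loc"
    then obtain a s b t where "a \<in> I" "s \<in> S" "x = frac_class R S a s"
      "b \<in> carrier R" "t \<in> S" "y = frac_class R S b t"
      by (auto simp: ext_ideal_def elim!: localization_carrierE)
    then show "y \<otimes>\<^bsub>Loc\<^esub> x \<in> ext_ideal I" "x \<otimes>\<^bsub>Loc\<^esub> y \<in> ext_ideal I"
      by (auto simp: localization_mult mem I.a_Hcarr I.I_l_closed I.I_r_closed)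
  qed
  then show ?thesis
  proof (rule primeidealI[OF _ L.is_cring])
    have "\<one> \<notin> I"
      using I by auto
    then have "frac_class R S \<one> \<one> \<notin> ext_ideal I"
      by (simp add: mem)
    then show "carrier Loc \<noteq> ext_ideal I"
      using frac_class_in_carrier[of \<one> \<one>] by force
  next
    fix x y assume "x \<in> carrier Loc" "y \<in> carrier Loc" "x \<otimes>\<^bsub>Loc\<^esub> y \<in> ext_ideal I"
    then show "x \<in> ext_ideal I \<or> y \<in> ext_ideal I"
      by (elim localization_carrierE) (auto simp: localization_mult mem dest: I.I_prime)
  qed
qed

lemma prime_chain_localization:
  assumes P: "prime_chain R n P" and disj: "P n \<inter> S = {}"
  shows "prime_chain Loc n (\<lambda>i. ext_ideal (P i))"
proof -
  have d: "P i \<inter> S = {}" if "i \<le> n" for i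
    using prime_chain_subset_last[OF P that] disj by blast
  have "ext_ideal (P i) \<subset> ext_ideal (P (Suc i))" if i: "i < n" for i
  proof -
    have *: "primeideal (P i) R" "P i \<subset> P (Suc i)"
      using P i by (auto simp: prime_chain_def)
    then obtain a where a: "a \<in> P (Suc i)" "a \<notin> P i" by blast
    interpret Q: primeideal "P (Suc i)" R
      using P i by (auto simp: prime_chain_def)
    have "frac_class R S a \<one> \<in> ext_ideal (P (Suc i))"
      using a one_closed unfolding ext_ideal_def by blast
    moreover have "frac_class R S a \<one> \<notin> ext_ideal (P i)"
      using a * i d by (simp add: frac_class_in_ext_ideal_iff Q.a_Hcarr)
    moreover have "ext_ideal (P i) \<subseteq> ext_ideal (P (Suc i))"
      using * by (auto simp: ext_ideal_def)
    ultimately show ?thesis by blast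
  qed
  then show ?thesis
    using P d by (auto simp: prime_chain_def primeideal_ext_ideal)
qed

end


section \<open>Prime ideals of a polynomial ring\<close>

context ring_hom_ring
begin

lemma coeff_map_ring_hom: "ring_hom_ring (UP R) (UP S) (\<lambda>f i. h (f i))"
proof -
  interpret RX: UP_ring R "UP R" by unfold_locales
  interpret SX: UP_ring S "UP S" by unfold_locales
  have up: "(\<lambda>i. h (f i)) \<in> up S" if f: "f \<in> up R" for f
  proof -
    obtain n where "bound \<zero>\<^bsub>R\<^esub> n f"
      using f by (auto simp: up_def)
    then have "bound \<zero>\<^bsub>S\<^esub> n (\<lambda>i. h (f i))"
      by (auto simp: bound_def)
    then show ?thesis
      using f by (intro mem_upI) (auto simp: mem_upD)
  qed
  show ?thesis
  proof (rule ring_hom_ringI[OF RX.UP_ring SX.UP_ring])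
    fix f g assume "f \<in> carrier (UP R)" "g \<in> carrier (UP R)"
    then have fg: "f \<in> up R" "g \<in> up R"
      by (auto simp: UP_def)
    then have "(\<lambda>i. f i \<otimes>\<^bsub>R\<^esub> g (n - i)) \<in> {..n} \<rightarrow> carrier R" for n
      by (auto simp: mem_upD)
    with fg up show "(\<lambda>i. h ((f \<otimes>\<^bsub>UP R\<^esub> g) i)) = (\<lambda>i. h (f i)) \<otimes>\<^bsub>UP S\<^esub> (\<lambda>i. h (g i))"
      by (auto simp: UP_def mem_upD fun_eq_iff o_def intro!: S.finsum_cong')
    show "(\<lambda>i. h ((f \<oplus>\<^bsub>UP R\<^esub> g) i)) = (\<lambda>i. h (f i)) \<oplus>\<^bsub>UP S\<^esub> (\<lambda>i. h (g i))"
      using fg up by (auto simp: UP_def mem_upD)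
  qed (auto simp: UP_def up)
qed

end

lemma (in ideal) minus_closed:
  assumes "a \<in> I" "b \<in> I"
  shows "a \<ominus> b \<in> I"
  unfolding minus_eq using assms
  by (auto intro!: additive_subgroup.a_closed additive_subgroup.a_inv_closed additive_subgroup_axioms)

lemma (in ideal) mem_iff_of_minus_mem:
  assumes "a \<in> carrier R" "b \<in> carrier R" "a \<ominus> b \<in> I"
  shows "a \<in> I \<longleftrightarrow> b \<in> I"
proof
  assume "a \<in> I"
  then have "a \<ominus> (a \<ominus> b) \<in> I"
    using assms(3) by (rule minus_closed)
  then show "b \<in> I"
    using assms by (simp add: minus_eq minus_add r_neg2)
next
  assume "b \<in> I"
  with assms(3) have "(a \<ominus> b) \<oplus> b \<in> I"
    by (rule additive_subgroup.a_closed[OF additive_subgroup_axioms])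
  then show "a \<in> I"
    using assms by (simp add: minus_eq a_assoc l_neg)
qed

context UP_cring
begin

text \<open>The extension \<open>I[X]\<close> of \<open>I\<close> to the polynomial ring.\<close>

definition poly_ideal where
  "poly_ideal I = {f \<in> carrier P. \<forall>i. coeff P f i \<in> I}"

text \<open>The ideal \<open>I + X R[X]\<close>.\<close>

definition const_ideal where
  "const_ideal I = {f \<in> carrier P. coeff P f 0 \<in> I}"

definition contraction where
  "contraction Q = {a \<in> carrier R. monom P a 0 \<in> Q}"

text \<open>
  The extension is the kernel of the reduction \<open>R[X] \<rightarrow> (R/I)[X]\<close>, whose target is a
  domain.
\<close>

lemma primeideal_poly_ideal:
  assumes "primeideal I R"
  shows "primeideal (poly_ideal I) P"
proof -
  interpret I: primeideal I R by fact
  have hom: "ring_hom_ring P (UP (R Quot I)) (\<lambda>f i. I +> f i)"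
    using ring_hom_ring.coeff_map_ring_hom[OF I.rcos_ring_hom_ring] by (simp add: P_def)
  have "domain (UP (R Quot I))"
    using I.quotient_is_domain by (intro UP_domain.UP_domain UP_domain.intro)
  note * = ring_hom_ring.primeideal_vimage[OF hom P.is_cring domain.zeroprimeideal[OF this]]
  have "I +> a = \<zero>\<^bsub>R Quot I\<^esub> \<longleftrightarrow> a \<in> I" if "a \<in> carrier R" for a
    using that I.rcos_const_imp_mem[of a] I.a_rcos_const[of a] by (auto simp: FactRing_def)
  then have "poly_ideal I = {f \<in> carrier P. (\<lambda>i. I +> f i) \<in> {\<zero>\<^bsub>UP (R Quot I)\<^esub>}}"
    by (auto simp: poly_ideal_def P_def UP_def fun_eq_iff mem_upD)
  then show ?thesis
    using * by simp
qed

lemma primeideal_const_ideal: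
  assumes "primeideal I R"
  shows "primeideal (const_ideal I) P"
proof -
  interpret h: ring_hom_ring P R "\<lambda>f. coeff P f 0"
    by (rule ring_hom_ringI) (auto simp: P.ring_axioms R.ring_axioms)
  show ?thesis
    using h.primeideal_vimage[OF P.is_cring assms] by (simp add: const_ideal_def)
qed

lemma primeideal_contraction:
  assumes "primeideal Q P"
  shows "primeideal (contraction Q) R"
proof -
  interpret h: ring_hom_ring R P "\<lambda>a. monom P a 0"
    using const_ring_hom by (rule ring_hom_ringI2[OF R.ring_axioms P.ring_axioms])
  show ?thesis
    using h.primeideal_vimage[OF R.is_cring assms] by (simp add: contraction_def)
qed

lemma poly_ideal_psubset_const_ideal:
  assumes "primeideal I R"
  shows "poly_ideal I \<subset> const_ideal I"
proof -
  interpret I: primeideal I R by fact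
  have "monom P \<one> 1 \<notin> poly_ideal I"
    using I.one_not_mem by (auto simp: poly_ideal_def)
  moreover have "monom P \<one> 1 \<in> const_ideal I"
    by (auto simp: const_ideal_def)
  moreover have "poly_ideal I \<subseteq> const_ideal I"
    by (auto simp: poly_ideal_def const_ideal_def)
  ultimately show ?thesis by blast
qed

lemma poly_ideal_psubset:
  assumes "primeideal J R" "I \<subset> J"
  shows "poly_ideal I \<subset> poly_ideal J"
proof -
  interpret J: primeideal J R by fact
  obtain a where a: "a \<in> J" "a \<notin> I"
    using assms by blast
  then have "monom P a 0 \<in> poly_ideal J" "monom P a 0 \<notin> poly_ideal I"
    by (auto simp: poly_ideal_def J.a_Hcarr)
  moreover have "poly_ideal I \<subseteq> poly_ideal J"
    using assms by (auto simp: poly_ideal_def)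
  ultimately show ?thesis by blast
qed

lemma contraction_mono: "Q \<subseteq> Q' \<Longrightarrow> contraction Q \<subseteq> contraction Q'"
  by (auto simp: contraction_def)

lemma poly_ideal_contraction_subset:
  assumes "primeideal Q P"
  shows "poly_ideal (contraction Q) \<subseteq> Q"
proof
  interpret Q: primeideal Q P by fact
  fix f assume f: "f \<in> poly_ideal (contraction Q)"
  then have fc: "f \<in> carrier P"
    by (simp add: poly_ideal_def)
  have mem: "monom P (coeff P f i) i \<in> Q" for i
  proof -
    have "monom P (coeff P f i) 0 \<in> Q"
      using f by (simp add: poly_ideal_def contraction_def)
    then have "monom P (coeff P f i) 0 \<otimes>\<^bsub>P\<^esub> monom P \<one> i \<in> Q"
      by (intro Q.I_r_closed) auto
    then show ?thesis
      using fc by (simp flip: monom_mult)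
  qed
  have "(\<Oplus>\<^bsub>P\<^esub> i \<in> A. monom P (coeff P f i) i) \<in> Q" if "finite A" for A
    using that by (induction A rule: finite_induct) (auto simp: P.finsum_insert mem fc)
  then show "f \<in> Q"
    using up_repr[OF fc] by (metis finite_atMost)
qed

text \<open>
  The ideal generated by \<open>Q\<close> in \<open>k(p)[X]\<close>, where \<open>p\<close> is the contraction of
  \<open>Q\<close>, is principal. In terms of \<open>R[X]\<close>, every \<open>u\<close> in \<open>Q\<close> is a
  multiple of one element \<open>f\<close> modulo \<open>p[X]\<close> and up to a constant factor outside
  \<open>p\<close>. Any \<open>f\<close> of minimal degree in \<open>Q\<close> outside \<open>p[X]\<close> works: division
  by \<open>f\<close> multiplies \<open>u\<close> by a power of the leading coefficient, and its remainder lies in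
  \<open>Q\<close> and is of smaller degree, hence lies in \<open>p[X]\<close>.
\<close>

lemma generic_generator:
  assumes Q: "primeideal Q P" and nsub: "\<not> Q \<subseteq> poly_ideal (contraction Q)"
  obtains f where "f \<in> Q" "f \<notin> poly_ideal (contraction Q)"
    "\<And>u. u \<in> Q \<Longrightarrow> \<exists>c \<in> carrier R - contraction Q. \<exists>s \<in> carrier P.
       monom P c 0 \<otimes>\<^bsub>P\<^esub> u \<ominus>\<^bsub>P\<^esub> f \<otimes>\<^bsub>P\<^esub> s \<in> poly_ideal (contraction Q)"
proof -
  let ?p = "contraction Q"
  interpret Q: primeideal Q P by fact
  interpret p: primeideal ?p R by (rule primeideal_contraction[OF Q])
  interpret pX: primeideal "poly_ideal ?p" P by (rule primeideal_poly_ideal[OF p.primeideal])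
  have sub: "poly_ideal ?p \<subseteq> Q"
    by (rule poly_ideal_contraction_subset[OF Q])
  obtain f where f: "f \<in> Q" "f \<notin> poly_ideal ?p"
    and min: "\<And>g. g \<in> Q \<Longrightarrow> g \<notin> poly_ideal ?p \<Longrightarrow> deg R f \<le> deg R g"
  proof -
    obtain g where "g \<in> Q \<and> g \<notin> poly_ideal ?p"
      using nsub by blast
    from ex_has_least_nat[of "\<lambda>f. f \<in> Q \<and> f \<notin> poly_ideal ?p", OF this, of "deg R"]
    show thesis
      using that by blast
  qed
  have fc: "f \<in> carrier P"
    using f(1) by (rule Q.a_Hcarr)
  let ?a = "coeff P f (deg R f)"
  have a: "?a \<in> carrier R"
    using fc by simp
  \<comment> \<open>A leading term with coefficient in \<open>p\<close> could be dropped, against minimality.\<close>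
  have "?a \<notin> ?p"
  proof
    assume ap: "?a \<in> ?p"
    let ?m = "monom P ?a (deg R f)"
    have m: "?m \<in> poly_ideal ?p"
      using monom_closed[OF a] ap p.zero_closed unfolding poly_ideal_def by (simp add: coeff_monom[OF a])
    have "deg R f \<noteq> 0"
      using deg_zero_impl_monom[OF fc] m f(2) by metis
    moreover have "deg R (\<ominus>\<^bsub>P\<^esub> ?m) \<le> deg R f"
      using a by (simp add: deg_monom_le)
    ultimately have "deg R (f \<oplus>\<^bsub>P\<^esub> \<ominus>\<^bsub>P\<^esub> ?m) < deg R f"
      using fc a by (intro deg_lcoeff_cancel) auto
    moreover have "f \<oplus>\<^bsub>P\<^esub> \<ominus>\<^bsub>P\<^esub> ?m \<in> Q"
      using f m sub by blast
    ultimately have "f \<oplus>\<^bsub>P\<^esub> \<ominus>\<^bsub>P\<^esub> ?m \<in> poly_ideal ?p"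
      using min leD by blast
    then have "(f \<oplus>\<^bsub>P\<^esub> \<ominus>\<^bsub>P\<^esub> ?m) \<oplus>\<^bsub>P\<^esub> ?m \<in> poly_ideal ?p"
      using m by (rule pX.a_closed)
    then show False
      using f fc a by (simp add: P.a_assoc P.l_neg)
  qed
  then have pow: "?a [^] k \<notin> ?p" for k :: nat
  proof (induction k)
    case 0
    then show ?case
      using p.one_not_mem by simp
  next
    case (Suc k)
    then show ?case
      using p.I_prime[of "?a [^] k" ?a] a by auto
  qed
  have "\<exists>c \<in> carrier R - ?p. \<exists>s \<in> carrier P. monom P c 0 \<otimes>\<^bsub>P\<^esub> u \<ominus>\<^bsub>P\<^esub> f \<otimes>\<^bsub>P\<^esub> s \<in> poly_ideal ?p"
    if u: "u \<in> Q" for u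
  proof -
    have uc: "u \<in> carrier P"
      using u by (rule Q.a_Hcarr)
    have "f \<noteq> \<zero>\<^bsub>P\<^esub>"
      using f by auto
    then obtain s r k where s: "s \<in> carrier P" and r: "r \<in> carrier P" "r = \<zero>\<^bsub>P\<^esub> \<or> deg R r < deg R f"
      and eq: "?a [^] (k::nat) \<odot>\<^bsub>P\<^esub> u = f \<otimes>\<^bsub>P\<^esub> s \<oplus>\<^bsub>P\<^esub> r"
      using long_div_theorem[OF fc uc] by blast
    let ?c = "?a [^] k"
    have r_eq: "monom P ?c 0 \<otimes>\<^bsub>P\<^esub> u \<ominus>\<^bsub>P\<^esub> f \<otimes>\<^bsub>P\<^esub> s = r"
      using eq a uc fc s r by (simp add: monom_mult_is_smult P.minus_eq P.a_ac P.r_neg)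
    have "monom P ?c 0 \<otimes>\<^bsub>P\<^esub> u \<ominus>\<^bsub>P\<^esub> f \<otimes>\<^bsub>P\<^esub> s \<in> Q"
      using f(1) u a s by (intro Q.minus_closed Q.I_l_closed Q.I_r_closed) auto
    then have "r \<in> poly_ideal ?p"
      using r(2) min[of r] pX.zero_closed leD unfolding r_eq by blast
    then have "monom P ?c 0 \<otimes>\<^bsub>P\<^esub> u \<ominus>\<^bsub>P\<^esub> f \<otimes>\<^bsub>P\<^esub> s \<in> poly_ideal ?p"
      unfolding r_eq .
    then show ?thesis
      using pow a s by blast
  qed
  then show thesis
    using that f by blast
qed

text \<open>
  Otherwise \<open>Q\<close> and \<open>Q'\<close> have generators \<open>f\<close> and \<open>h\<close> in the sense of
  \<open>generic_generator\<close>, and \<open>c f = h q\<close> modulo \<open>p[X]\<close>. As \<open>Q\<close> is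
  prime, it contains \<open>h\<close> or \<open>q\<close>. In the first case it contains \<open>Q'\<close>. In the
  second case \<open>d q = f s\<close> modulo \<open>p[X]\<close>. Then \<open>f\<close> can be cancelled from
  \<open>d c f = f h s\<close>, because \<open>p[X]\<close> is prime, and modulo \<open>p[X]\<close> the element
  \<open>h\<close> divides the constant \<open>d c\<close> outside \<open>p\<close>, which cannot lie in
  \<open>Q'\<close>.
\<close>

lemma eq_poly_ideal_of_psubset:
  assumes Q: "primeideal Q P" and Q': "primeideal Q' P" and sub: "Q \<subset> Q'"
    and eq: "contraction Q' = contraction Q"
  shows "Q = poly_ideal (contraction Q)"
proof (rule ccontr)
  let ?p = "contraction Q"
  assume neq: "Q \<noteq> poly_ideal ?p"
  interpret Q: primeideal Q P by fact
  interpret Q': primeideal Q' P by fact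
  interpret p: primeideal ?p R by (rule primeideal_contraction[OF Q])
  interpret pX: primeideal "poly_ideal ?p" P by (rule primeideal_poly_ideal[OF p.primeideal])
  have pX: "poly_ideal ?p \<subseteq> Q"
    by (rule poly_ideal_contraction_subset[OF Q])
  have nsub: "\<not> Q \<subseteq> poly_ideal ?p"
    using neq pX by blast
  then have nsub': "\<not> Q' \<subseteq> poly_ideal ?p"
    using sub by blast
  obtain f where f: "f \<in> Q" "f \<notin> poly_ideal ?p"
    and f_gen: "\<And>u. u \<in> Q \<Longrightarrow> \<exists>c \<in> carrier R - ?p. \<exists>s \<in> carrier P.
       monom P c 0 \<otimes>\<^bsub>P\<^esub> u \<ominus>\<^bsub>P\<^esub> f \<otimes>\<^bsub>P\<^esub> s \<in> poly_ideal ?p"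
    using generic_generator[OF Q nsub] by metis
  obtain h where h: "h \<in> Q'"
    and h_gen: "\<And>u. u \<in> Q' \<Longrightarrow> \<exists>c \<in> carrier R - ?p. \<exists>s \<in> carrier P.
       monom P c 0 \<otimes>\<^bsub>P\<^esub> u \<ominus>\<^bsub>P\<^esub> h \<otimes>\<^bsub>P\<^esub> s \<in> poly_ideal ?p"
    using generic_generator[OF Q', unfolded eq, OF nsub'] by metis
  have fc: "f \<in> carrier P" and hc: "h \<in> carrier P"
    using f h by (auto simp: Q.a_Hcarr Q'.a_Hcarr)
  obtain c q where c: "c \<in> carrier R" "c \<notin> ?p" and q: "q \<in> carrier P"
    and cq: "monom P c 0 \<otimes>\<^bsub>P\<^esub> f \<ominus>\<^bsub>P\<^esub> h \<otimes>\<^bsub>P\<^esub> q \<in> poly_ideal ?p"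
    using h_gen[of f] f sub by blast
  let ?c = "monom P c 0"
  have "?c \<otimes>\<^bsub>P\<^esub> f \<in> Q"
    using f c by (intro Q.I_l_closed) auto
  then have "h \<otimes>\<^bsub>P\<^esub> q \<in> Q"
    using Q.mem_iff_of_minus_mem[OF _ _ subsetD[OF pX cq]] c fc hc q by simp
  then consider "h \<in> Q" | "q \<in> Q"
    using Q.I_prime hc q by blast
  then show False
  proof cases
    case 1
    have "u \<in> Q" if u: "u \<in> Q'" for u
    proof -
      obtain d s where d: "d \<in> carrier R" "d \<notin> ?p" and s: "s \<in> carrier P"
        and *: "monom P d 0 \<otimes>\<^bsub>P\<^esub> u \<ominus>\<^bsub>P\<^esub> h \<otimes>\<^bsub>P\<^esub> s \<in> poly_ideal ?p"
        using h_gen[OF u] by blast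
      have uc: "u \<in> carrier P"
        using u by (rule Q'.a_Hcarr)
      have dc: "monom P d 0 \<in> carrier P"
        using d(1) by (rule monom_closed)
      have "h \<otimes>\<^bsub>P\<^esub> s \<in> Q"
        using 1 s by (rule Q.I_r_closed)
      then have "monom P d 0 \<otimes>\<^bsub>P\<^esub> u \<in> Q"
        using Q.mem_iff_of_minus_mem[OF _ _ subsetD[OF pX *]] dc uc hc s by (metis UP_mult_closed)
      moreover have "monom P d 0 \<notin> Q"
        using d unfolding contraction_def by blast
      ultimately show "u \<in> Q"
        using Q.I_prime uc dc by blast
    qed
    then show False
      using sub by blast
  next
    case 2
    obtain d s where d: "d \<in> carrier R" "d \<notin> ?p" and s: "s \<in> carrier P"
      and ds: "monom P d 0 \<otimes>\<^bsub>P\<^esub> q \<ominus>\<^bsub>P\<^esub> f \<otimes>\<^bsub>P\<^esub> s \<in> poly_ideal ?p"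
      using f_gen[OF 2] by blast
    let ?d = "monom P d 0"
    have carr: "?c \<in> carrier P" "?d \<in> carrier P"
      using c d by auto
    \<comment> \<open>The combination that eliminates \<open>q\<close> from the two congruences.\<close>
    have "?d \<otimes>\<^bsub>P\<^esub> (?c \<otimes>\<^bsub>P\<^esub> f \<ominus>\<^bsub>P\<^esub> h \<otimes>\<^bsub>P\<^esub> q) \<oplus>\<^bsub>P\<^esub> h \<otimes>\<^bsub>P\<^esub> (?d \<otimes>\<^bsub>P\<^esub> q \<ominus>\<^bsub>P\<^esub> f \<otimes>\<^bsub>P\<^esub> s) =
        f \<otimes>\<^bsub>P\<^esub> (?d \<otimes>\<^bsub>P\<^esub> ?c \<ominus>\<^bsub>P\<^esub> h \<otimes>\<^bsub>P\<^esub> s)"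
      using carr fc hc q s by algebra
    moreover have "?d \<otimes>\<^bsub>P\<^esub> (?c \<otimes>\<^bsub>P\<^esub> f \<ominus>\<^bsub>P\<^esub> h \<otimes>\<^bsub>P\<^esub> q) \<oplus>\<^bsub>P\<^esub> h \<otimes>\<^bsub>P\<^esub> (?d \<otimes>\<^bsub>P\<^esub> q \<ominus>\<^bsub>P\<^esub> f \<otimes>\<^bsub>P\<^esub> s)
        \<in> poly_ideal ?p"
      using cq ds carr hc by (intro pX.a_closed pX.I_l_closed)
    ultimately have "?d \<otimes>\<^bsub>P\<^esub> ?c \<ominus>\<^bsub>P\<^esub> h \<otimes>\<^bsub>P\<^esub> s \<in> poly_ideal ?p"
      using pX.I_prime[of f "?d \<otimes>\<^bsub>P\<^esub> ?c \<ominus>\<^bsub>P\<^esub> h \<otimes>\<^bsub>P\<^esub> s"] f fc carr hc s by simp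
    then have "?d \<otimes>\<^bsub>P\<^esub> ?c \<ominus>\<^bsub>P\<^esub> h \<otimes>\<^bsub>P\<^esub> s \<in> Q'"
      using pX sub by blast
    moreover have "h \<otimes>\<^bsub>P\<^esub> s \<in> Q'"
      using h s by (rule Q'.I_r_closed)
    ultimately have "?d \<otimes>\<^bsub>P\<^esub> ?c \<in> Q'"
      using Q'.mem_iff_of_minus_mem[of "?d \<otimes>\<^bsub>P\<^esub> ?c" "h \<otimes>\<^bsub>P\<^esub> s"] carr hc s
      by (metis UP_mult_closed)
    then have "?d \<in> Q' \<or> ?c \<in> Q'"
      using Q'.I_prime carr by blast
    then show False
      using c d unfolding eq[symmetric] unfolding contraction_def by blast
  qed
qed


section \<open>Dimension of a polynomial ring\<close>

text \<open>
  Induction along the chain, by comparing the top prime \<open>Q\<close> with its predecessor \<open>Q1\<close>.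
  If both lie over the same prime, \<open>Q1\<close> is already the extended prime. If not, it suffices to
  find a chain that is shorter by two and ends strictly below the extension of the contraction of
  \<open>Q\<close>. Such a chain is the original one without its two top primes if \<open>Q1\<close> is
  itself an extended prime, and comes from the induction hypothesis for \<open>Q1\<close> otherwise.
\<close>

lemma prime_chain_to_poly_ideal:
  assumes "prime_chain P (Suc d) C" "C (Suc d) \<noteq> poly_ideal (contraction (C (Suc d)))"
  shows "\<exists>D. prime_chain P d D \<and> D d = poly_ideal (contraction (C (Suc d)))"
  using assms
proof (induction d arbitrary: C)
  case 0
  then have "primeideal (C 1) P"
    by (simp add: prime_chain_def)
  then have "prime_chain P 0 (\<lambda>_. poly_ideal (contraction (C 1)))"
    by (simp add: prime_chain_def primeideal_poly_ideal primeideal_contraction)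
  then show ?case by auto
next
  case (Suc d)
  let ?Q = "C (Suc (Suc d))" and ?Q1 = "C (Suc d)"
  have prime: "primeideal ?Q P" "primeideal ?Q1 P" and less: "?Q1 \<subset> ?Q" "C d \<subset> ?Q1"
    using Suc.prems by (auto simp: prime_chain_def)
  have C1: "prime_chain P (Suc d) C"
    by (rule prime_chain_butlast[OF Suc.prems(1)])
  show ?case
  proof (cases "contraction ?Q1 = contraction ?Q")
    case True
    then have "?Q1 = poly_ideal (contraction ?Q)"
      using eq_poly_ideal_of_psubset[OF prime(2,1) less(1)] by simp
    then show ?thesis
      using C1 by blast
  next
    case False
    then have "contraction ?Q1 \<subset> contraction ?Q"
      using contraction_mono less by blast
    then have lt: "poly_ideal (contraction ?Q1) \<subset> poly_ideal (contraction ?Q)"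
      by (intro poly_ideal_psubset primeideal_contraction prime)
    obtain D where D: "prime_chain P d D" "D d \<subset> poly_ideal (contraction ?Q)"
    proof (cases "?Q1 = poly_ideal (contraction ?Q1)")
      case True
      show ?thesis
        by (rule that[of C]) (use C1 less lt True in \<open>auto intro: prime_chain_butlast\<close>)
    next
      case False
      then show ?thesis
        using Suc.IH[OF C1] lt that by metis
    qed
    have "prime_chain P (Suc d) (D(Suc d := poly_ideal (contraction ?Q)))"
      by (intro prime_chain_snoc D primeideal_poly_ideal primeideal_contraction prime)
    moreover have "(D(Suc d := poly_ideal (contraction ?Q))) (Suc d) = poly_ideal (contraction ?Q)"
      by simp
    ultimately show ?thesis by blast
  qed
qed

text \<open>
  The chain is only brought below \<open>I + X R[X]\<close>, not up to it: if its top is the extended prime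
  \<open>I[X]\<close> already, it is left unchanged.
\<close>

lemma prime_chain_to_const_ideal:
  assumes C: "prime_chain P d C"
  obtains D I where "prime_chain P d D" "primeideal I R" "D d \<subseteq> const_ideal I"
proof -
  define I where "I = contraction (C d)"
  have I: "primeideal I R"
    using C unfolding I_def prime_chain_def by (intro primeideal_contraction) auto
  show thesis
  proof (cases "C d = poly_ideal I")
    case True
    then show thesis
      using that C I poly_ideal_psubset_const_ideal[OF I] by blast
  next
    case False
    show thesis
    proof (cases d)
      case 0
      show thesis
      proof (rule that[OF _ I])
        show "prime_chain P d (\<lambda>_. const_ideal I)"
          using 0 primeideal_const_ideal[OF I] by (simp add: prime_chain_def)
      qed simp
    next
      case (Suc e)
      then obtain D where D: "prime_chain P e D" "D e = poly_ideal I"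
        using prime_chain_to_poly_ideal[of e C] C False unfolding I_def by auto
      have "prime_chain P d (D(Suc e := const_ideal I))"
        unfolding Suc by (rule prime_chain_snoc[OF D(1) primeideal_const_ideal[OF I]])
          (simp add: D poly_ideal_psubset_const_ideal[OF I])
      then show thesis
        by (rule that[OF _ I]) (simp add: Suc)
    qed
  qed
qed

text \<open>
  If \<open>C (2 * i)\<close> and \<open>C (2 * i + 2)\<close> had the same contraction, then both
  \<open>C (2 * i)\<close> and \<open>C (2 * i + 1)\<close> would be its extension.
\<close>

lemma prime_chain_contraction:
  assumes C: "prime_chain P d C"
  shows "prime_chain R (d div 2) (\<lambda>i. contraction (C (2 * i)))"
  unfolding prime_chain_def
proof (intro conjI allI impI)
  fix i assume "i \<le> d div 2"
  then show "primeideal (contraction (C (2 * i))) R"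
    using C by (intro primeideal_contraction) (auto simp: prime_chain_def)
next
  fix i assume i: "i < d div 2"
  let ?Q = "C (2 * i)" and ?Q1 = "C (Suc (2 * i))" and ?Q2 = "C (Suc (Suc (2 * i)))"
  have prime: "primeideal ?Q P" "primeideal ?Q1 P" "primeideal ?Q2 P"
    and less: "?Q \<subset> ?Q1" "?Q1 \<subset> ?Q2"
    using C i by (auto simp: prime_chain_def)
  have mono: "contraction ?Q \<subseteq> contraction ?Q1" "contraction ?Q1 \<subseteq> contraction ?Q2"
    using less by (auto intro!: contraction_mono)
  have "contraction ?Q \<noteq> contraction ?Q2"
  proof
    assume "contraction ?Q = contraction ?Q2"
    then have "contraction ?Q1 = contraction ?Q" "contraction ?Q2 = contraction ?Q1"
      using mono by auto
    then have "?Q = ?Q1"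
      using eq_poly_ideal_of_psubset prime less by metis
    then show False
      using less by blast
  qed
  then show "contraction (C (2 * i)) \<subset> contraction (C (2 * Suc i))"
    using mono by auto
qed

lemma prime_chain_poly_ideal:
  assumes C: "prime_chain R n C"
  shows "prime_chain P (Suc n) ((\<lambda>i. poly_ideal (C i))(Suc n := const_ideal (C n)))"
proof (rule prime_chain_snoc)
  have "primeideal (C n) R"
    using C by (simp add: prime_chain_def)
  then show "primeideal (const_ideal (C n)) P" "poly_ideal (C n) \<subset> const_ideal (C n)"
    by (rule primeideal_const_ideal, rule poly_ideal_psubset_const_ideal)
  show "prime_chain P n (\<lambda>i. poly_ideal (C i))"
    using C by (intro prime_chain_map[OF C]) (auto simp: prime_chain_def primeideal_poly_ideal poly_ideal_psubset)
qed

end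


section \<open>The Anderson ring\<close>

theorem proposition2p4:
  fixes R (structure)
  assumes "cring R" and "\<one> \<noteq> \<zero>" and "krull_dim R \<noteq> \<infinity>"
  shows "krull_dim (UP R) = krull_dim (anderson_ring R) \<and>
    (\<forall>n. krull_dim R = enat n \<longrightarrow>
      enat (n + 1) \<le> krull_dim (anderson_ring R) \<and>
      krull_dim (anderson_ring R) \<le> enat (2 * n + 1))"
proof -
  interpret cring R by fact
  interpret X: UP_cring R "UP R"
    by unfold_locales
  interpret A: mult_submonoid "UP R" "anderson_set R"
    by (rule mult_submonoid_anderson) fact
  have disj: "Q \<inter> anderson_set R = {}" if "primeideal I R" "Q \<subseteq> X.const_ideal I" for I Q
  proof -
    have "\<one> \<notin> I"
      using that(1) by (rule primeideal.one_not_mem)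
    then show ?thesis
      using that(2) unfolding X.const_ideal_def anderson_set_def by force
  qed
  have le: "krull_dim (UP R) \<le> krull_dim (anderson_ring R)"
  proof (rule krull_dim_mono)
    fix d C assume "prime_chain (UP R) d C"
    then obtain D I where "prime_chain (UP R) d D" "primeideal I R" "D d \<subseteq> X.const_ideal I"
      by (rule X.prime_chain_to_const_ideal)
    then show "\<exists>C'. prime_chain (anderson_ring R) d C'"
      using A.prime_chain_localization disj unfolding anderson_ring_def by blast
  qed
  have eq: "krull_dim (UP R) = krull_dim (anderson_ring R)"
    using le A.krull_dim_localization_le unfolding anderson_ring_def by (rule order_antisym)
  have "enat (n + 1) \<le> krull_dim (UP R)" "krull_dim (UP R) \<le> enat (2 * n + 1)"
    if n: "krull_dim R = enat n" for n
  proof -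
    obtain C where "prime_chain R n C"
      using prime_chain_of_krull_dim[OF assms(2) n] by blast
    from prime_chain_le_krull_dim[OF X.prime_chain_poly_ideal[OF this]]
    show "enat (n + 1) \<le> krull_dim (UP R)"
      by simp
    show "krull_dim (UP R) \<le> enat (2 * n + 1)"
    proof (rule krull_dim_leI)
      fix d C assume "prime_chain (UP R) d C"
      from prime_chain_le_krull_dim[OF X.prime_chain_contraction[OF this]]
      have "d div 2 \<le> n"
        using n by simp
      then show "enat d \<le> enat (2 * n + 1)"
        by simp
    qed
  qed
  with eq show ?thesis by simp
qed

end
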